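(* Let $F\in\mathcal S(]-\infty,0],\mathbb C)$. For every $N\in\mathbb N=\{0,1,2,\dots\}$ and every real $t\le 0$, $$F(t)=\sum_{n=0}^{N}\frac{F^{(n)}(0)}{n!}t^n+\frac{1}{2i\pi}\int_{\Re(s)=N+\frac12}\Gamma(-s)\,F^{(s)}(0)\,(-t)^s\,ds .$$
   Context: $\mathcal S(]-\infty,0],\mathbb C)$ is the space of functions $F\in C^\infty(]-\infty,0],\mathbb C)$ (one-sided derivatives at $0$) such that $\lim_{t\to-\infty}|t|^mF^{(n)}(t)=0$ for all integers $n,m\ge 0$. For such $F$, define $F^{(s)}(0)=\frac{1}{\Gamma(-s)}\int_0^{+\infty}u^{-s-1}F(-u)\,du$ for $\Re(s)<0$; this function of $s$ extends to an entire function, still denoted $s\mapsto F^{(s)}(0)$, which at $s=n\in\mathbb N$ equals the usual $n$-th derivative. The integral over $\Re(s)=c$ is along the upward oriented vertical line from $c-i\infty$ to $c+i\infty$. For $t<0$, $(-t)^s=e^{s\ln(-t)}$; for $t=0$ and $\Re(s)>0$, $(-t)^s=0$. *)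

theory Defs
  imports "HOL-Complex_Analysis.Complex_Analysis"
begin

text \<open>
  Functions on \<open>]-\<infinity>,0]\<close> are total functions whose values on \<open>]0,\<infinity>[\<close> are irrelevant:
  derivatives are taken within \<open>{..0}\<close>, hence are left derivatives at \<open>0\<close>.
\<close>

primrec halfline_deriv :: "nat \<Rightarrow> (real \<Rightarrow> complex) \<Rightarrow> real \<Rightarrow> complex" where
  "halfline_deriv 0 F = F"
| "halfline_deriv (Suc n) F = (\<lambda>t. vector_derivative (halfline_deriv n F) (at t within {..0}))"

definition smooth_halfline :: "(real \<Rightarrow> complex) \<Rightarrow> bool" where
  "smooth_halfline F \<longleftrightarrow>
     (\<forall>n. \<forall>t\<le>0. halfline_deriv n F differentiable (at t within {..0}))"

definition schwartz_halfline :: "(real \<Rightarrow> complex) set" where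
  "schwartz_halfline = {F. smooth_halfline F \<and>
     (\<forall>n m. ((\<lambda>t. of_real (\<bar>t\<bar> ^ m) * halfline_deriv n F t) \<longlongrightarrow> 0) at_bot)}"

text \<open>
  The complex-order derivative \<open>F\<^sup>(\<^sup>s\<^sup>)(0)\<close>, as a function of \<open>s\<close>: the entire extension of the
  normalised Mellin transform. By the identity theorem there is at most one such extension.
\<close>

definition complex_deriv0 :: "(real \<Rightarrow> complex) \<Rightarrow> complex \<Rightarrow> complex" where
  "complex_deriv0 F = (THE G. G holomorphic_on UNIV \<and>
     (\<forall>s. Re s < 0 \<longrightarrow>
        G s = 1 / Gamma (- s) *
          (LINT u:{0<..}|lborel. complex_of_real u powr (- s - 1) * F (- u))))"

text \<open>
  Integrals along the upward oriented line \<open>Re s = c\<close>, parametrised by \<open>s = c + \<i> y\<close>, \<open>ds = \<i> dy\<close>.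
\<close>

definition vline_integrable :: "real \<Rightarrow> (complex \<Rightarrow> complex) \<Rightarrow> bool" where
  "vline_integrable c g \<longleftrightarrow> integrable lborel (\<lambda>y. g (Complex c y) * \<i>)"

definition vline_integral :: "real \<Rightarrow> (complex \<Rightarrow> complex) \<Rightarrow> complex" where
  "vline_integral c g = (LINT y|lborel. g (Complex c y) * \<i>)"

end

theory Submission
  imports Defs "HOL-Probability.Probability" "HOL-Real_Asymp.Real_Asymp"
begin

text \<open>
  Substituting \<open>u = e\<^sup>x\<close> turns the Mellin transform of \<open>u \<mapsto> F(-u)\<close> into a Fourier integral, so on the
  line \<open>Re s = -1/2\<close>, where \<open>\<Gamma>(-s) F\<^sup>(\<^sup>s\<^sup>)(0)\<close> is that Mellin transform at \<open>-s\<close>, Fourier inversion gives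
  \<open>F(t)\<close> itself. Integration by parts gives \<open>\<Gamma>(-s) F\<^sup>(\<^sup>s\<^sup>)(0) = - \<Gamma>(1-s) (F')\<^sup>(\<^sup>s\<^sup>-\<^sup>1\<^sup>)(0) / s\<close>. Hence
  integrating the formula for \<open>F'\<close> on the line \<open>Re s = N - 1/2\<close> over \<open>[t, 0]\<close> yields the
  formula for \<open>F\<close> on the line \<open>Re s = N + 1/2\<close>, with one more Taylor term and without shifting any contour.
\<close>

section \<open>Fourier inversion\<close>

text \<open>The base line \<open>Re s = -1/2\<close> answers two constraints:
  \<open>Re s < 0\<close> makes the Mellin integral converge at \<open>-s\<close>, and
  \<open>Re s > -1\<close> makes v^s integrable at 0, so that integrating the formula for F' over
  ]0, x[ can be exchanged with the integral over \<open>y\<close>. The exchange also needs absolute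
  integrability along the line. Two integrations by parts give quadratic decay on the base line, and
  every later step only divides by an \<open>s\<close> bounded away from 0, so no estimate of
  \<open>Gamma\<close> on vertical lines is required. A separate obstacle is that
  \<open>complex_deriv0\<close> is a definite description: nothing can be said about it before the
  entire extension has been constructed. Integration by parts provides it too, since the normalised
  transform of the k-th derivative makes sense on \<open>Re s < k\<close>.\<close>

text \<open>A unimodular phase does not affect absolute integrability, so |a| |b| dominates. It
  serves with \<open>k v = x - v\<close> in the Gaussian argument and with \<open>k v = ln v\<close>
  in the induction on lines; hence only measurability of \<open>k\<close> is asked.\<close>

lemma Fubini_phase:
  fixes a b :: "real \<Rightarrow> complex" and k :: "real \<Rightarrow> real"
  assumes a: "integrable lborel a" and b: "integrable lborel b" and k[measurable]: "k \<in> borel_measurable borel"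
  shows "(LINT v|lborel. LINT y|lborel. a y * b v * exp (\<i> * of_real (y * k v))) =
         (LINT y|lborel. LINT v|lborel. a y * b v * exp (\<i> * of_real (y * k v)))"
proof -
  have [measurable]: "a \<in> borel_measurable borel" "b \<in> borel_measurable borel"
    using a b by auto
  have nm: "norm (exp (\<i> * complex_of_real r)) = 1" for r
    using norm_exp_i_times by simp
  have *: "integrable (lborel \<Otimes>\<^sub>M lborel) (\<lambda>(y, v). a y * b v * exp (\<i> * of_real (y * k v)))"
  proof (rule lborel_pair.Fubini_integrable)
    show "integrable lborel (\<lambda>x. LINT y|lborel. norm ((\<lambda>(y, v). a y * b v * exp (\<i> * of_real (y * k v))) (x, y)))"
      using a b by (simp add: norm_mult nm del: of_real_mult)
    show "AE x in lborel. integrable lborel (\<lambda>y. (\<lambda>(y, v). a y * b v * exp (\<i> * of_real (y * k v))) (x, y))"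
    proof (rule AE_I2)
      fix x
      have "integrable lborel (\<lambda>y. a x * b y)" using b by simp
      then show "integrable lborel (\<lambda>y. (\<lambda>(y, v). a y * b v * exp (\<i> * of_real (y * k v))) (x, y))"
        by (rule Bochner_Integration.integrable_bound) (auto simp: norm_mult nm simp del: of_real_mult)
    qed
  qed measurable
  show ?thesis using lborel_pair.Fubini_integral[OF *] .
qed

lemma std_normal_Fourier:
  "(LINT y|lborel. exp (\<i> * of_real (y * x)) * of_real (std_normal_density y)) = exp (- (of_real x)\<^sup>2 / 2)"
proof -
  have "char std_normal_distribution x = complex_of_real (exp (- (x^2) / 2))"
    by (simp add: char_std_normal_distribution)
  then show ?thesis
    unfolding char_def
    by (subst (asm) integral_density) (auto simp: exp_of_real [symmetric] scaleR_conv_of_real mult_ac)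
qed

text \<open>
  Damping the inverse transform by a Gaussian makes Fubini applicable and turns it into a Gaussian
  average of \<open>h\<close> around \<open>x\<close>; both sides converge when the damping is removed.
\<close>

lemma Fourier_inversion:
  fixes h :: "real \<Rightarrow> complex"
  defines "fh \<equiv> \<lambda>y. LINT \<xi>|lborel. h \<xi> * iexp (- (y * \<xi>))"
  assumes h: "integrable lborel h" and cont: "continuous_on UNIV h" and bdd: "bounded (range h)"
    and fh: "integrable lborel fh"
  shows "(LINT y|lborel. fh y * iexp (y * x)) = 2 * of_real pi * h x"
proof -
  let ?g = "\<lambda>y. complex_of_real (std_normal_density y)"
  have [measurable]: "h \<in> borel_measurable borel" "fh \<in> borel_measurable borel"
    using h fh by auto
  have g: "integrable lborel ?g"
    by (simp add: integrable_normal_density[of 1 0, simplified])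
  \<comment> \<open>Exchange the integrals, evaluate the inner Gaussian integral, then substitute
    \<open>\<xi> = x + e * w\<close>. The factor sqrt(2 pi) appears when exp(-w^2/2) is rewritten as
    a multiple of the normal density.\<close>
  have smoothed: "(LINT y|lborel. ?g (e * y) * fh y * iexp (y * x)) =
      of_real (sqrt (2 * pi)) * (LINT w|lborel. ?g w * h (x + e * w))" if "e > 0" for e
  proof -
    have ge: "integrable lborel (\<lambda>y. ?g (e * y))"
      using lborel_integrable_real_affine[OF g, of e 0] that by simp
    have inner: "(LINT y|lborel. ?g (e * y) * h \<xi> * iexp (y * (x - \<xi>))) =
        h \<xi> * (exp (- (of_real ((x - \<xi>) / e))\<^sup>2 / 2) / of_real e)" for \<xi>
    proof -
      have "(LINT y|lborel. iexp (y * ((x - \<xi>) / e)) * ?g y) =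
          e *\<^sub>R (LINT y|lborel. iexp (y * (x - \<xi>)) * ?g (e * y))"
        using lborel_integral_real_affine[of e "\<lambda>y. iexp (y * ((x - \<xi>) / e)) * ?g y" 0] that
        by (simp add: mult_ac)
      then have "(LINT y|lborel. iexp (y * (x - \<xi>)) * ?g (e * y)) =
          exp (- (of_real ((x - \<xi>) / e))\<^sup>2 / 2) / of_real e"
        unfolding std_normal_Fourier scaleR_conv_of_real using that by simp
      moreover have "(LINT y|lborel. ?g (e * y) * h \<xi> * iexp (y * (x - \<xi>))) =
        (LINT y|lborel. h \<xi> * (iexp (y * (x - \<xi>)) * ?g (e * y)))"
        by (intro Bochner_Integration.integral_cong) (auto simp: mult_ac)
      ultimately show ?thesis by simp
    qed
    have "(LINT y|lborel. ?g (e * y) * fh y * iexp (y * x)) =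
        (LINT y|lborel. LINT \<xi>|lborel. ?g (e * y) * h \<xi> * iexp (y * (x - \<xi>)))"
    proof (intro Bochner_Integration.integral_cong refl)
      fix y
      have "?g (e * y) * h \<xi> * iexp (y * (x - \<xi>)) =
          (?g (e * y) * iexp (y * x)) * (h \<xi> * iexp (- (y * \<xi>)))" for \<xi>
        by (simp add: mult_exp_exp algebra_simps)
      then show "?g (e * y) * fh y * iexp (y * x) =
        (LINT \<xi>|lborel. ?g (e * y) * h \<xi> * iexp (y * (x - \<xi>)))"
        unfolding fh_def by (simp only: integral_mult_right_zero) (simp only: mult_ac)
    qed
    also have "\<dots> = (LINT \<xi>|lborel. LINT y|lborel. ?g (e * y) * h \<xi> * iexp (y * (x - \<xi>)))"
      by (intro Fubini_phase[symmetric] ge h) measurable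
    also have "\<dots> = (LINT \<xi>|lborel. h \<xi> * (exp (- (of_real ((x - \<xi>) / e))\<^sup>2 / 2) / of_real e))"
      by (simp only: inner)
    also have "\<dots> = e *\<^sub>R (LINT w|lborel. h (x + e * w) * (exp (- (of_real w)\<^sup>2 / 2) / of_real e))"
      by (subst lborel_integral_real_affine[where c=e and t=x]) (use that in auto)
    also have "\<dots> = (LINT w|lborel. h (x + e * w) * (exp (- (of_real w)\<^sup>2 / 2)))"
      using that by (simp add: scaleR_conv_of_real)
    also have "\<dots> = (LINT w|lborel. of_real (sqrt (2 * pi)) * (?g w * h (x + e * w)))"
      by (intro Bochner_Integration.integral_cong refl)
         (simp add: std_normal_density_def exp_of_real[symmetric])
    finally show ?thesis by simp
  qed
  \<comment> \<open>Damping parameters tending to 0 along a sequence, as dominated convergence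
    requires, and positive, as \<open>smoothed\<close> requires.\<close>
  define e where "e n = inverse (real (Suc n))" for n
  have e: "e n > 0" for n by (simp add: e_def)
  have e0: "e \<longlonglongrightarrow> 0" unfolding e_def by (rule LIMSEQ_inverse_real_of_nat)
  have g_cont: "continuous_on UNIV ?g"
    unfolding std_normal_density_def by (intro continuous_intros) auto
  have g_bd: "norm (?g y) \<le> 1" for y
  proof -
    have "1 \<le> sqrt (2 * pi)" using pi_gt3 by simp
    then have "1 / sqrt (2 * pi) * exp (- y\<^sup>2 / 2) \<le> 1 * 1"
      by (intro mult_mono) auto
    then have "std_normal_density y \<le> 1" by (simp add: std_normal_density_def)
    then show ?thesis by (simp only: norm_of_real) simp
  qed
  obtain K where K: "\<And>y. norm (h y) \<le> K" using bdd by (auto simp: bounded_iff)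
  have "(\<lambda>n. LINT y|lborel. ?g (e n * y) * fh y * iexp (y * x)) \<longlonglongrightarrow>
      (LINT y|lborel. ?g (0 * y) * fh y * iexp (y * x))"
  proof (rule integral_dominated_convergence[where w="\<lambda>y. norm (fh y)"])
    show "AE y in lborel. (\<lambda>n. ?g (e n * y) * fh y * iexp (y * x)) \<longlonglongrightarrow> ?g (0 * y) * fh y * iexp (y * x)"
      by (intro AE_I2 tendsto_intros continuous_on_tendsto_compose[OF g_cont] e0) auto
    show "AE y in lborel. norm (?g (e n * y) * fh y * iexp (y * x)) \<le> norm (fh y)" for n
    proof (rule AE_I2)
      fix y
      have "norm (?g (e n * y)) * norm (fh y) \<le> 1 * norm (fh y)"
        by (intro mult_right_mono g_bd) auto
      then show "norm (?g (e n * y) * fh y * iexp (y * x)) \<le> norm (fh y)"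
        by (simp add: norm_mult del: of_real_mult)
    qed
  qed (use fh in auto)
  moreover have "(\<lambda>n. of_real (sqrt (2 * pi)) * (LINT w|lborel. ?g w * h (x + e n * w))) \<longlonglongrightarrow>
      of_real (sqrt (2 * pi)) * (LINT w|lborel. ?g w * h (x + 0 * w))"
  proof (intro tendsto_intros integral_dominated_convergence[where w="\<lambda>w. norm (?g w) * K"])
    show "integrable lborel (\<lambda>w. norm (?g w) * K)"
      using g by (intro integrable_mult_left) (rule integrable_norm)
    show "AE w in lborel. (\<lambda>n. ?g w * h (x + e n * w)) \<longlonglongrightarrow> ?g w * h (x + 0 * w)"
      by (intro AE_I2 tendsto_intros continuous_on_tendsto_compose[OF cont] e0) auto
    show "AE w in lborel. norm (?g w * h (x + e n * w)) \<le> norm (?g w) * K" for n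
      by (intro AE_I2) (auto simp: norm_mult intro!: mult_left_mono K)
  qed measurable
  ultimately have "(LINT y|lborel. ?g (0 * y) * fh y * iexp (y * x)) =
      of_real (sqrt (2 * pi)) * (LINT w|lborel. ?g w * h (x + 0 * w))"
    by (simp only: smoothed[OF e] LIMSEQ_unique)
  \<comment> \<open>In the limit the damping is the constant \<open>?g 0\<close>, which is 1 /
    sqrt(2 pi); together with the sqrt(2 pi) on the right it produces the factor 2 pi.\<close>
  then have "?g 0 * (LINT y|lborel. fh y * iexp (y * x)) = of_real (sqrt (2 * pi)) * ((LINT w|lborel. ?g w) * h x)"
    by (simp add: mult.assoc del: of_real_mult)
  also have "(LINT w|lborel. ?g w) = 1"
    using integral_normal_density[of 1 0] by simp
  finally have "(LINT y|lborel. fh y * iexp (y * x)) = of_real (sqrt (2 * pi)) * h x / ?g 0"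
    by (simp add: std_normal_density_def divide_eq_eq)
  also have "\<dots> = of_real (sqrt (2 * pi) * sqrt (2 * pi)) * h x"
    by (simp add: std_normal_density_def del: real_sqrt_mult_self)
  also have "sqrt (2 * pi) * sqrt (2 * pi) = 2 * pi" by (simp only: real_sqrt_mult_self) simp
  finally show ?thesis by simp
qed

section \<open>Schwartz functions on the half-line and their Mellin transforms\<close>

lemma halfline_deriv_add: "halfline_deriv n (halfline_deriv m F) = halfline_deriv (n + m) F"
  by (induction n) auto

lemma schwartz_halfline_deriv:
  "F \<in> schwartz_halfline \<Longrightarrow> halfline_deriv m F \<in> schwartz_halfline"
  unfolding schwartz_halfline_def smooth_halfline_def by (simp add: halfline_deriv_add)

lemma schwartz_has_vector_derivative_within:
  assumes "F \<in> schwartz_halfline" "t \<le> 0"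
  shows "(F has_vector_derivative halfline_deriv 1 F t) (at t within {..0})"
proof -
  have "halfline_deriv 0 F differentiable (at t within {..0})"
    using assms unfolding schwartz_halfline_def smooth_halfline_def by blast
  then show ?thesis by (simp add: vector_derivative_works)
qed

lemma schwartz_has_vector_derivative:
  assumes "F \<in> schwartz_halfline" "t < 0"
  shows "(F has_vector_derivative halfline_deriv 1 F t) (at t)"
proof -
  have "(F has_vector_derivative halfline_deriv 1 F t) (at t within {..<0})"
    using assms
    by (intro has_vector_derivative_within_subset[OF schwartz_has_vector_derivative_within[of F t]]) (simp_all add: subset_iff)
  moreover have "at t within {..<0} = at t"
    using assms(2) by (intro at_within_open) simp_all
  ultimately show ?thesis by simp
qed

lemma schwartz_continuous_on:
  assumes "F \<in> schwartz_halfline"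
  shows "continuous_on {..0} F"
  unfolding continuous_on_eq_continuous_within
proof
  fix t :: real assume "t \<in> {..0}"
  then show "continuous (at t within {..0}) F"
    using schwartz_has_vector_derivative_within[OF assms, of t]
    by (simp add: has_vector_derivative_continuous)
qed

lemma schwartz_continuous_exp:
  assumes "F \<in> schwartz_halfline"
  shows "continuous_on A (\<lambda>x::real. F (- exp x))"
proof (rule continuous_on_compose2[OF schwartz_continuous_on[OF assms]])
  show "continuous_on A (\<lambda>x::real. - exp x)"
    by (intro continuous_intros)
qed auto

text \<open>Below some \<open>T\<close> the limit at minus infinity gives the bound 1; on the
  compact remainder \<open>{T..0}\<close> continuity gives \<open>B\<close>.\<close>

lemma schwartz_decay:
  assumes F: "F \<in> schwartz_halfline"
  shows "\<exists>K\<ge>0. \<forall>u\<ge>0. u ^ m * norm (F (- u)) \<le> K"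
proof -
  have "((\<lambda>t. of_real (\<bar>t\<bar> ^ m) * halfline_deriv 0 F t) \<longlongrightarrow> 0) at_bot"
    using F unfolding schwartz_halfline_def by blast
  then have "eventually (\<lambda>t. dist (of_real (\<bar>t\<bar> ^ m) * F t) 0 < 1) at_bot"
    by (intro tendstoD) auto
  then obtain T where T: "\<And>t. t \<le> T \<Longrightarrow> norm (of_real (\<bar>t\<bar> ^ m) * F t) < 1"
    by (auto simp: eventually_at_bot_linorder)
  have "compact ((\<lambda>t. of_real (\<bar>t\<bar> ^ m) * F t) ` {T..0})"
    by (intro compact_continuous_image continuous_intros continuous_on_subset[OF schwartz_continuous_on[OF F]]) auto
  then obtain B where B: "\<And>t. t \<in> {T..0} \<Longrightarrow> norm (of_real (\<bar>t\<bar> ^ m) * F t) \<le> B"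
    by (meson bounded_iff compact_imp_bounded imageI)
  show ?thesis
  proof (intro exI[of _ "max 1 B"] conjI allI impI)
    fix u :: real assume "u \<ge> 0"
    then have "norm (of_real (\<bar>-u\<bar> ^ m) * F (- u)) \<le> max 1 B"
      using T[of "-u"] B[of "-u"] by (cases "- u \<le> T") (auto simp del: of_real_power)
    then show "u ^ m * norm (F (- u)) \<le> max 1 B"
      using \<open>u \<ge> 0\<close> by (simp add: norm_mult norm_power)
  qed auto
qed

text \<open>Trades exponential decay for the single integrable majorant C / (1 + x^2) used
  throughout. The constant comes from exp u \<ge> 1 + u^2/2 at u = a |x|, since (1 + 2/a^2)(1 + a^2
  x^2/2) already contains 1 + x^2.\<close>

lemma exp_neg_abs_le:
  fixes a x :: real
  assumes "a > 0"
  shows "exp (- (a * \<bar>x\<bar>)) \<le> (1 + 2 / a\<^sup>2) / (1 + x\<^sup>2)"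
proof -
  have e: "1 + (a * \<bar>x\<bar>)\<^sup>2 / 2 \<le> exp (a * \<bar>x\<bar>)"
    using exp_lower_Taylor_quadratic[of "a * \<bar>x\<bar>"] assms
    by (smt (verit) mult_nonneg_nonneg abs_ge_zero)
  have "1 + x\<^sup>2 \<le> (1 + 2 / a\<^sup>2) * (1 + (a * \<bar>x\<bar>)\<^sup>2 / 2)"
    using assms by (simp add: field_simps power_mult_distrib)
  also have "\<dots> \<le> (1 + 2 / a\<^sup>2) * exp (a * \<bar>x\<bar>)"
    by (intro mult_left_mono e) auto
  finally have "(1 + x\<^sup>2) / exp (a * \<bar>x\<bar>) \<le> 1 + 2 / a\<^sup>2"
    by (simp add: field_simps)
  then show ?thesis
    by (simp add: exp_minus field_simps add_pos_nonneg)
qed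

lemma integrable_inverse_1_plus_square': "integrable lborel (\<lambda>x::real. C / (1 + x\<^sup>2))"
proof -
  have "integrable lborel (\<lambda>x::real. C * inverse (1 + x\<^sup>2))"
    using integrable_inverse_1_plus_square by (simp add: set_integrable_def)
  then show ?thesis by (simp add: divide_inverse)
qed

text \<open>At minus infinity the exponential decays because Re z \<ge> a > 0 and \<open>F\<close>
  is bounded; at plus infinity the decay of \<open>F\<close> in u = e^x wins because Re z \<le> b.
  The constant is uniform over the strip, which later yields both locally uniform convergence and
  boundedness on vertical lines.\<close>

lemma schwartz_exp_bound:
  assumes F: "F \<in> schwartz_halfline" and a: "0 < a"
  shows "\<exists>C\<ge>0. \<forall>z x. a \<le> Re z \<longrightarrow> Re z \<le> b \<longrightarrow>
     norm (exp (z * of_real x) * F (- exp x)) \<le> C / (1 + x\<^sup>2)"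
proof -
  \<comment> \<open>One power of u more than needed to absorb e^(b x); the surplus leaves a factor
    e^(-x).\<close>
  define m where "m = nat \<lceil>b\<rceil> + 1"
  have m: "b \<le> real m - 1" unfolding m_def by linarith
  obtain K where K: "K \<ge> 0" "\<And>u. u \<ge> 0 \<Longrightarrow> u ^ 0 * norm (F (- u)) \<le> K"
    using schwartz_decay[OF F, of 0] by blast
  obtain L where L: "L \<ge> 0" "\<And>u. u \<ge> 0 \<Longrightarrow> u ^ m * norm (F (- u)) \<le> L"
    using schwartz_decay[OF F, of m] by blast
  define C where "C = K * (1 + 2 / a\<^sup>2) + L * (1 + 2 / 1\<^sup>2)"
  show ?thesis
  proof (intro exI[of _ C] conjI allI impI)
    show "C \<ge> 0" unfolding C_def using K(1) L(1) by auto
    fix z :: complex and x :: real assume z: "a \<le> Re z" "Re z \<le> b"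
    have n: "norm (exp (z * of_real x) * F (- exp x)) = exp (Re z * x) * norm (F (- exp x))"
      by (simp add: norm_mult)
    show "norm (exp (z * of_real x) * F (- exp x)) \<le> C / (1 + x\<^sup>2)"
    proof (cases "x \<le> 0")
      case True
      have "exp (Re z * x) * norm (F (- exp x)) \<le> exp (- (a * \<bar>x\<bar>)) * K"
        using True z K(2)[of "exp x"] by (intro mult_mono) (auto simp: mult_right_mono_neg)
      also have "\<dots> \<le> (1 + 2 / a\<^sup>2) / (1 + x\<^sup>2) * K"
        using K(1) a by (intro mult_right_mono exp_neg_abs_le)
      also have "\<dots> = K * (1 + 2 / a\<^sup>2) / (1 + x\<^sup>2)" by simp
      also have "\<dots> \<le> C / (1 + x\<^sup>2)"
        unfolding C_def using L(1) by (intro divide_right_mono) auto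
      finally show ?thesis using n by simp
    next
      case False
      have "Re z * x \<le> (real m - 1) * x" using False z m by (intro mult_right_mono) auto
      then have "exp (Re z * x) \<le> exp (real m * x + - (1 * \<bar>x\<bar>))"
        using False by (simp add: algebra_simps)
      also have "\<dots> = exp x ^ m * exp (- (1 * \<bar>x\<bar>))"
        by (simp only: exp_add exp_of_nat_mult)
      finally have "exp (Re z * x) * norm (F (- exp x)) \<le> (exp x ^ m * exp (- (1 * \<bar>x\<bar>))) * norm (F (- exp x))"
        by (intro mult_right_mono) auto
      also have "\<dots> = (exp x ^ m * norm (F (- exp x))) * exp (- (1 * \<bar>x\<bar>))" by simp
      also have "\<dots> \<le> L * exp (- (1 * \<bar>x\<bar>))"
        using L(2)[of "exp x"] by (intro mult_right_mono) auto
      also have "\<dots> \<le> L * ((1 + 2 / 1\<^sup>2) / (1 + x\<^sup>2))"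
        using L(1) by (intro mult_left_mono exp_neg_abs_le) auto
      also have "\<dots> = L * (1 + 2 / 1\<^sup>2) / (1 + x\<^sup>2)" by simp
      also have "\<dots> \<le> C / (1 + x\<^sup>2)"
        unfolding C_def using K(1) a by (intro divide_right_mono) auto
      finally show ?thesis using n by simp
    qed
  qed
qed

text \<open>The Mellin transform of \<open>u \<mapsto> F(-u)\<close>, written in the variable \<open>x = ln u\<close>.\<close>

definition mellin :: "(real \<Rightarrow> complex) \<Rightarrow> complex \<Rightarrow> complex" where
  "mellin F z = (LINT x|lborel. exp (z * of_real x) * F (- exp x))"

lemma mellin_integrable:
  assumes F: "F \<in> schwartz_halfline" and z: "Re z > 0"
  shows "integrable lborel (\<lambda>x. exp (z * of_real x) * F (- exp x))"
proof -
  obtain C where "C \<ge> 0" "\<And>x. norm (exp (z * of_real x) * F (- exp x)) \<le> C / (1 + x\<^sup>2)"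
    using schwartz_exp_bound[OF F z, of "Re z"] by blast
  moreover have "(\<lambda>x. exp (z * of_real x) * F (- exp x)) \<in> borel_measurable borel"
    by (intro borel_measurable_continuous_onI continuous_intros schwartz_continuous_exp[OF F])
  ultimately show ?thesis
    by (intro Bochner_Integration.integrable_bound[OF integrable_inverse_1_plus_square'[of C]])
       (use \<open>C \<ge> 0\<close> in auto)
qed

text \<open>The integral of the derivative of e^(z x) F(-e^x) is zero, because this function
  vanishes at both ends. The inner derivative -e^x raises the argument by 1, and its sign cancels
  the minus sign of integration by parts.\<close>

lemma mellin_by_parts:
  assumes F: "F \<in> schwartz_halfline" and z: "Re z > 0"
  shows "z * mellin F z = mellin (halfline_deriv 1 F) (z + 1)"
proof -
  define F' where "F' = halfline_deriv 1 F"
  have F': "F' \<in> schwartz_halfline" unfolding F'_def by (rule schwartz_halfline_deriv[OF F])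
  define f where "f x = exp (z * of_real x) * F (- exp x)" for x :: real
  define g where "g x = z * f x - exp ((z + 1) * of_real x) * F' (- exp x)" for x :: real
  have z1: "Re (z + 1) > 0" using z by simp
  have f_int: "integrable lborel f" unfolding f_def by (rule mellin_integrable[OF F z])
  have F'_int: "integrable lborel (\<lambda>x. exp ((z + 1) * of_real x) * F' (- exp x))"
    by (rule mellin_integrable[OF F' z1])
  have g_int: "integrable lborel g"
    unfolding g_def using f_int F'_int by auto
  have deriv: "(f has_vector_derivative g x) (at x)" for x
  proof -
    have "((\<lambda>x. - exp x) has_vector_derivative - exp x) (at x)"
      by (auto intro!: derivative_eq_intros simp flip: has_real_derivative_iff_has_vector_derivative)
    from vector_diff_chain_at[OF this, of F] schwartz_has_vector_derivative[OF F, of "- exp x"]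
    have 1: "((\<lambda>x. F (- exp x)) has_vector_derivative (- exp x) *\<^sub>R F' (- exp x)) (at x)"
      by (simp add: o_def F'_def)
    have 2: "((\<lambda>x. exp (z * of_real x)) has_vector_derivative z * exp (z * of_real x)) (at x)"
      by (rule has_vector_derivative_real_field) (auto intro!: derivative_eq_intros)
    have "(f has_vector_derivative exp (z * of_real x) * ((- exp x) *\<^sub>R F' (- exp x)) + z * exp (z * of_real x) * F (- exp x)) (at x)"
      unfolding f_def by (rule has_vector_derivative_mult[OF 2 1])
    also have "exp (z * of_real x) * ((- exp x) *\<^sub>R F' (- exp x)) + z * exp (z * of_real x) * F (- exp x) = g x"
      by (simp add: g_def f_def scaleR_conv_of_real exp_of_real[symmetric] ring_distribs exp_add)
    finally show ?thesis .
  qed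
  obtain C where C: "\<And>x. norm (f x) \<le> C / (1 + x\<^sup>2)"
    unfolding f_def using schwartz_exp_bound[OF F z, of "Re z"] by blast
  have lim: "(f \<longlongrightarrow> 0) at_top" "(f \<longlongrightarrow> 0) at_bot"
  proof -
    have "((\<lambda>x::real. 1 / (1 + x\<^sup>2)) \<longlongrightarrow> 0) at_top" by real_asymp
    from tendsto_mult_right_zero[OF this, of C] show "(f \<longlongrightarrow> 0) at_top"
      by (intro Lim_null_comparison[OF always_eventually[OF allI[OF C]]]) simp
    have "((\<lambda>x::real. 1 / (1 + x\<^sup>2)) \<longlongrightarrow> 0) at_bot" by real_asymp
    from tendsto_mult_right_zero[OF this, of C] show "(f \<longlongrightarrow> 0) at_bot"
      by (intro Lim_null_comparison[OF always_eventually[OF allI[OF C]]]) simp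
  qed
  have cont: "isCont g x" for x
  proof -
    have "continuous_on UNIV g" unfolding g_def f_def
      by (intro continuous_intros schwartz_continuous_exp F F')
    then show ?thesis by (simp add: continuous_on_eq_continuous_at)
  qed
  have "(LBINT x=-\<infinity>..\<infinity>. g x) = 0 - 0"
  proof (rule interval_integral_FTC_integrable[where F = f])
    show "set_integrable lborel (einterval (-\<infinity>) \<infinity>) g"
      using g_int by (simp add: set_integrable_def)
    show "((f \<circ> real_of_ereal) \<longlongrightarrow> 0) (at_right (- \<infinity>))" "((f \<circ> real_of_ereal) \<longlongrightarrow> 0) (at_left \<infinity>)"
      unfolding ereal_tendsto_simps using lim by auto
  qed (use deriv cont in auto)
  then have "(LINT x|lborel. g x) = 0"
    by (simp add: interval_lebesgue_integral_def set_lebesgue_integral_def)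
  moreover have "(LINT x|lborel. g x) = z * mellin F z - mellin F' (z + 1)"
    unfolding g_def mellin_def f_def[symmetric] using f_int F'_int
    by (subst Bochner_Integration.integral_diff) auto
  ultimately show ?thesis by (simp add: F'_def)
qed

text \<open>The integrals truncated to [-n, n] are holomorphic by differentiation under the integral
  sign. Their distance to the full integral is at most the tail \<open>r n\<close> of a majorant
  independent of the point, so convergence is locally uniform.\<close>

lemma mellin_holomorphic:
  assumes F: "F \<in> schwartz_halfline"
  shows "mellin F holomorphic_on {z. Re z > 0}"
proof -
  define h where "h z x = exp (z * complex_of_real x) * F (- exp x)" for z and x :: real
  define f where "f n z = integral (cbox (- real n) (real n)) (h z)" for n z
  have cont: "continuous_on A (h z)" for A z
    unfolding h_def by (intro continuous_intros schwartz_continuous_exp F)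
  show ?thesis
  proof (rule holomorphic_uniform_sequence[where f = f])
    show "open {z. Re z > 0}" by (rule open_halfspace_Re_gt)
    show "f n holomorphic_on {z. Re z > 0}" for n
      unfolding f_def
    proof (rule leibniz_rule_holomorphic[where fx = "\<lambda>z x. of_real x * h z x"])
      show "((\<lambda>z. h z x) has_field_derivative of_real x * h z x) (at z within {z. Re z > 0})" for z x
        unfolding h_def by (auto intro!: derivative_eq_intros)
      show "h z integrable_on cbox (- real n) (real n)" for z
        by (intro integrable_continuous cont)
      show "continuous_on ({z. Re z > 0} \<times> cbox (- real n) (real n)) (\<lambda>(z, x). of_real x * h z x)"
      proof -
        have "continuous_on ({z. Re z > 0} \<times> cbox (- real n) (real n)) (\<lambda>p. F (- exp (snd p)))"
          by (rule continuous_on_compose2[OF schwartz_continuous_exp[OF F, of UNIV] continuous_on_snd[OF continuous_on_id]]) simp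
        then show ?thesis
          unfolding h_def case_prod_unfold by (intro continuous_intros)
      qed
    qed (rule convex_halfspace_Re_gt)
    show "\<exists>d>0. cball z d \<subseteq> {z. Re z > 0} \<and> uniform_limit (cball z d) f (mellin F) sequentially"
      if "z \<in> {z. Re z > 0}" for z
    proof (intro exI conjI)
      \<comment> \<open>The closed disc of this radius stays in the strip d \<le> Re w \<le> 3 d,
        where one constant \<open>C\<close> serves for all points.\<close>
      define d where "d = Re z / 2"
      show d: "d > 0" using that by (simp add: d_def)
      have Re: "d \<le> Re w \<and> Re w \<le> 3 * d" if "w \<in> cball z d" for w
        using that abs_Re_le_cmod[of "z - w"] unfolding d_def by (auto simp: dist_norm abs_le_iff)
      then show "cball z d \<subseteq> {z. Re z > 0}" using d by fastforce
      obtain C where C0: "C \<ge> 0" and C: "\<And>w x. d \<le> Re w \<Longrightarrow> Re w \<le> 3 * d \<Longrightarrow>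
          norm (exp (w * of_real x) * F (- exp x)) \<le> C / (1 + x\<^sup>2)"
        using schwartz_exp_bound[OF F d, of "3 * d"] by blast
      define r where "r n = (LINT x|lborel. (1 - indicator {- real n..real n} x) * (C / (1 + x\<^sup>2)))" for n
      have "r \<longlonglongrightarrow> (LINT x|(lborel :: real measure). 0 :: real)"
        unfolding r_def
      proof (rule integral_dominated_convergence[where w = "\<lambda>x. C / (1 + x\<^sup>2)"])
        show "AE x in lborel. (\<lambda>n. (1 - indicator {- real n..real n} x) * (C / (1 + x\<^sup>2))) \<longlonglongrightarrow> 0"
        proof (rule AE_I2, rule tendsto_eventually)
          fix x :: real
          have "eventually (\<lambda>n. real n \<ge> \<bar>x\<bar>) sequentially"
            by real_asymp
          then show "eventually (\<lambda>n. (1 - indicator {- real n..real n} x) * (C / (1 + x\<^sup>2)) = 0) sequentially"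
              by eventually_elim (auto simp: indicator_def abs_le_iff)
        qed
        show "AE x in lborel. norm ((1 - indicator {- real n..real n} x) * (C / (1 + x\<^sup>2))) \<le> C / (1 + x\<^sup>2)" for n
          by (rule AE_I2) (simp add: indicator_def C0)
        show "integrable lborel (\<lambda>x. C / (1 + x\<^sup>2))" by (rule integrable_inverse_1_plus_square')
      qed measurable
      then have r: "r \<longlonglongrightarrow> 0" by simp
      have le: "norm (f n w - mellin F w) \<le> r n" if w: "w \<in> cball z d" for n w
      proof -
        have int: "integrable lborel (h w)"
          unfolding h_def using Re[OF w] d by (intro mellin_integrable[OF F]) auto
        have si: "set_integrable lborel {- real n..real n} (h w)"
          by (rule borel_integrable_atLeastAtMost'[OF cont])
        have int': "integrable lborel (\<lambda>x. indicator {- real n..real n} x *\<^sub>R h w x)"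
          using si by (simp add: set_integrable_def)
        have "f n w = (LINT x|lborel. indicator {- real n..real n} x *\<^sub>R h w x)"
          using set_borel_integral_eq_integral(2)[OF si] by (simp add: f_def set_lebesgue_integral_def)
        then have "norm (f n w - mellin F w) = norm (LINT x|lborel. indicator {- real n..real n} x *\<^sub>R h w x - h w x)"
          unfolding mellin_def h_def[symmetric] using int int' by simp
        also have "\<dots> \<le> (LINT x|lborel. norm (indicator {- real n..real n} x *\<^sub>R h w x - h w x))"
          by (rule integral_norm_bound)
        also have "\<dots> \<le> r n" unfolding r_def
        proof (rule integral_mono)
          show "integrable lborel (\<lambda>x. norm (indicator {- real n..real n} x *\<^sub>R h w x - h w x))"
            by (intro integrable_norm Bochner_Integration.integrable_diff int int')
          show "integrable lborel (\<lambda>x. (1 - indicator {- real n..real n} x) * (C / (1 + x\<^sup>2)))"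
            by (rule Bochner_Integration.integrable_bound[OF integrable_inverse_1_plus_square'[of C]])
               (measurable, simp add: indicator_def C0)
          show "norm (indicator {- real n..real n} x *\<^sub>R h w x - h w x) \<le>
              (1 - indicator {- real n..real n} x) * (C / (1 + x\<^sup>2))" for x
            using C[of w x] Re[OF w] by (cases "x \<in> {- real n..real n}") (simp_all add: h_def)
        qed
        finally show ?thesis .
      qed
      show "uniform_limit (cball z d) f (mellin F) sequentially"
      proof (rule uniform_limitI)
        fix e :: real assume "e > 0"
        from order_tendstoD(2)[OF r this]
        show "\<forall>\<^sub>F n in sequentially. \<forall>w\<in>cball z d. dist (f n w) (mellin F w) < e"
          by eventually_elim (auto simp: dist_norm intro: le_less_trans[OF le])
      qed
    qed
  qed
qed

section \<open>Derivatives of complex order at zero\<close>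

lemma powr_of_real_pos: "u > 0 \<Longrightarrow> complex_of_real u powr w = exp (w * of_real (ln u))"
  by (simp add: powr_def Ln_of_real)

lemma mellin_powr:
  assumes F: "F \<in> schwartz_halfline" and z: "Re z > 0"
  shows "(LINT u:{0<..}|lborel. complex_of_real u powr (z - 1) * F (- u)) = mellin F z"
proof -
  define p where "p u = complex_of_real u powr (z - 1) * F (- u)" for u :: real
  have cont: "continuous_on {0<..} p"
  proof -
    have "continuous_on {0<..} (\<lambda>u. F (- u))"
    proof (rule continuous_on_compose2[OF schwartz_continuous_on[OF F]])
      show "continuous_on {0<..} (\<lambda>u::real. - u)" by (intro continuous_intros)
    qed auto
    then have "continuous_on {0<..} (\<lambda>u. exp ((z - 1) * of_real (ln u)) * F (- u))"
      by (intro continuous_intros) simp_all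
    then show ?thesis
      by (rule continuous_on_eq) (simp add: p_def powr_of_real_pos)
  qed
  then have isCont: "isCont p u" if "u > 0" for u
    using that by (simp add: continuous_on_eq_continuous_at)
  have subst: "exp x *\<^sub>R p (exp x) = exp (z * of_real x) * F (- exp x)" for x
  proof -
    have "p (exp x) = exp ((z - 1) * of_real x) * F (- exp x)"
      unfolding p_def by (subst powr_of_real_pos) simp_all
    then have "exp x *\<^sub>R p (exp x) = exp (of_real x + (z - 1) * of_real x) * F (- exp x)"
      unfolding exp_add by (simp add: scaleR_conv_of_real exp_of_real)
    then show ?thesis by (simp add: ring_distribs)
  qed
  have lim: "((ereal \<circ> exp \<circ> real_of_ereal) \<longlongrightarrow> 0) (at_right (- \<infinity>))"
            "((ereal \<circ> exp \<circ> real_of_ereal) \<longlongrightarrow> \<infinity>) (at_left \<infinity>)"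
    unfolding zero_ereal_def ereal_tendsto_simps by (simp_all add: exp_at_bot exp_at_top)
  have int: "integrable lborel (\<lambda>x. exp x *\<^sub>R p (exp x))"
    unfolding subst by (rule mellin_integrable[OF F z])
  then have int': "set_integrable lborel (einterval (- \<infinity>) \<infinity>) (\<lambda>x. exp x *\<^sub>R p (exp x))"
    by (simp add: set_integrable_def)
  have "integrable lborel (\<lambda>x. norm (exp x *\<^sub>R p (exp x)))"
    using int by (rule integrable_norm)
  then have norm_int: "set_integrable lborel (einterval (- \<infinity>) \<infinity>) (\<lambda>x. norm (p (exp x)) * exp x)"
    by (simp add: set_integrable_def mult.commute)
  \<comment> \<open>The substitution rule for complex integrands asks for integrability on both
    sides. The rule for nonnegative functions, applied to the norm, carries it from the variable x =
    ln u back to u.\<close>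
  have A: "set_integrable lborel (einterval 0 \<infinity>) (\<lambda>u. norm (p u))"
  proof (rule interval_integral_substitution_nonneg(1)[where f = "\<lambda>u. norm (p u)" and g = exp and g' = exp, OF _ _ _ _ _ _ lim norm_int])
    show "DERIV exp x :> exp x" for x :: real by (rule DERIV_exp)
    show "isCont (\<lambda>a. norm (p a)) (exp x)" for x
      by (intro continuous_intros isCont) simp
  qed simp_all
  have einterval: "einterval 0 \<infinity> = {0<..}" by (auto simp: einterval_def)
  have meas: "set_borel_measurable lborel (einterval 0 \<infinity>) p"
    unfolding einterval set_borel_measurable_def measurable_lborel1
    using borel_measurable_continuous_on_indicator[OF _ cont] by simp
  have p_int: "set_integrable lborel (einterval 0 \<infinity>) p"
    by (rule set_integrable_bound[OF A meas]) simp
  have "(LBINT u=0..\<infinity>. p u) = (LBINT x=-\<infinity>..\<infinity>. exp x *\<^sub>R p (exp x))"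
  proof (rule interval_integral_substitution_integrable[where f = p and g = exp and g' = exp, OF _ _ _ _ _ lim int' p_int])
    show "DERIV exp x :> exp x" for x :: real by (rule DERIV_exp)
    show "isCont p (exp x)" for x
      by (intro isCont) simp
  qed simp_all
  also have "\<dots> = mellin F z"
    by (simp only: subst) (simp add: interval_lebesgue_integral_def set_lebesgue_integral_def mellin_def)
  also have "(LBINT u=0..\<infinity>. p u) = (LINT u:{0<..}|lborel. p u)"
    by (simp add: interval_lebesgue_integral_def einterval)
  finally show ?thesis by (simp add: p_def)
qed

text \<open>The factor z from integration by parts is absorbed by z rGamma(z + 1) = rGamma(z). Since
  \<open>rGamma\<close> is entire and the right-hand side makes sense for Re z > -k, this is the
  form that continues analytically.\<close>

lemma mellin_rGamma_shift:
  assumes F: "F \<in> schwartz_halfline" and z: "Re z > 0"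
  shows "mellin F z * rGamma z = mellin (halfline_deriv k F) (z + of_nat k) * rGamma (z + of_nat k)"
proof (induction k)
  case (Suc k)
  have "mellin (halfline_deriv k F) w * rGamma w = mellin (halfline_deriv (Suc k) F) (w + 1) * rGamma (w + 1)"
    if "Re w > 0" for w
  proof -
    have "mellin (halfline_deriv k F) w * rGamma w = w * mellin (halfline_deriv k F) w * rGamma (w + 1)"
      by (subst rGamma_plus1[symmetric]) (simp only: mult_ac)
    then show ?thesis
      using mellin_by_parts[OF schwartz_halfline_deriv[OF F, of k] that]
      by (simp add: halfline_deriv_add)
  qed
  from this[of "z + of_nat k"] Suc.IH z show ?case by (simp add: add_ac)
qed simp

text \<open>Settles existence and uniqueness for the definite description at once: the expressions
  for different \<open>k\<close> agree on overlaps by the shift identity and glue to an entire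
  function, and the identity theorem from the half-plane \<open>Re s < 0\<close> excludes any
  other.\<close>

lemma complex_deriv0_eq:
  assumes F: "F \<in> schwartz_halfline" and s: "Re s < real k"
  shows "complex_deriv0 F s = mellin (halfline_deriv k F) (of_nat k - s) * rGamma (of_nat k - s)"
proof -
  define E where "E k s = mellin (halfline_deriv k F) (of_nat k - s) * rGamma (of_nat k - s)" for k s
  have mono: "E k s = E l s" if "Re s < real k" "k \<le> l" for k l s
    using mellin_rGamma_shift[OF schwartz_halfline_deriv[OF F, of k], of "of_nat k - s" "l - k"] that
    by (simp add: E_def halfline_deriv_add of_nat_diff)
  \<comment> \<open>Any level above \<open>Re s\<close> would do; two levels are compared through
    their maximum.\<close>
  define G where "G s = E (nat \<lceil>Re s\<rceil> + 1) s" for s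
  have G_eq: "G s = E k s" if "Re s < real k" for s k
  proof -
    have "Re s < real (nat \<lceil>Re s\<rceil> + 1)" by linarith
    then show ?thesis
      using mono[of s "nat \<lceil>Re s\<rceil> + 1" "max k (nat \<lceil>Re s\<rceil> + 1)"] mono[OF that, of "max k (nat \<lceil>Re s\<rceil> + 1)"]
      by (simp add: G_def)
  qed
  have hol: "G holomorphic_on UNIV"
  proof -
    have "G holomorphic_on (\<Union>k\<in>UNIV. {s. Re s < real k})"
    proof (rule holomorphic_on_UN_open)
      fix k
      have "(mellin (halfline_deriv k F) \<circ> (\<lambda>s. of_nat k - s)) holomorphic_on {s. Re s < real k}"
        by (rule holomorphic_on_compose_gen[OF _ mellin_holomorphic[OF schwartz_halfline_deriv[OF F]]])
           (auto intro!: holomorphic_intros)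
      then have "E k holomorphic_on {s. Re s < real k}"
        unfolding E_def o_def by (intro holomorphic_intros)
      then show "G holomorphic_on {s. Re s < real k}"
        by (rule holomorphic_transform) (simp add: G_eq)
    qed (rule open_halfspace_Re_lt)
    moreover have "(\<Union>k\<in>UNIV. {s. Re s < real k}) = UNIV"
      using reals_Archimedean2 by auto
    ultimately show ?thesis by simp
  qed
  have G0: "G s = 1 / Gamma (- s) * (LINT u:{0<..}|lborel. complex_of_real u powr (- s - 1) * F (- u))"
    if "Re s < 0" for s
    using G_eq[of s 0] that mellin_powr[OF F, of "- s"]
    by (simp add: E_def rGamma_inverse_Gamma divide_inverse)
  have "complex_deriv0 F = G"
    unfolding complex_deriv0_def
  proof (rule the_equality)
    fix H assume H: "H holomorphic_on UNIV \<and> (\<forall>s. Re s < 0 \<longrightarrow>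
        H s = 1 / Gamma (- s) * (LINT u:{0<..}|lborel. complex_of_real u powr (- s - 1) * F (- u)))"
    show "H = G"
    proof
      fix s
      show "H s = G s"
      proof (rule analytic_continuation_open[where s = "{s. Re s < 0}" and s' = UNIV and f = H and g = G])
        show "open {s. Re s < 0}" by (rule open_halfspace_Re_lt)
        have "- 1 \<in> {s. Re s < 0}" by simp
        then show "{s. Re s < 0} \<noteq> {}" by blast
        show "H z = G z" if "z \<in> {s. Re s < 0}" for z
          using that H G0 by simp
      qed (use H hol in \<open>simp_all add: connected_UNIV\<close>)
    qed
  qed (use hol G0 in simp)
  then show ?thesis using G_eq[OF s] by (simp add: E_def)
qed

section \<open>Mellin transforms on vertical lines and their inversion\<close>

lemma mellin_continuous_line:
  assumes "F \<in> schwartz_halfline" "c > 0"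
  shows "continuous_on UNIV (\<lambda>y. mellin F (Complex c (- y)))"
proof (rule continuous_on_compose2[OF holomorphic_on_imp_continuous_on[OF mellin_holomorphic[OF assms(1)]]])
  show "continuous_on UNIV (\<lambda>y. Complex c (- y))"
    unfolding Complex_eq by (intro continuous_intros)
qed (use assms(2) in auto)

lemma mellin_bounded_line:
  assumes F: "F \<in> schwartz_halfline" and c: "c > 0"
  shows "\<exists>B\<ge>0. \<forall>z. Re z = c \<longrightarrow> norm (mellin F z) \<le> B"
proof -
  obtain C where C0: "C \<ge> 0" and C: "\<And>z x. c \<le> Re z \<Longrightarrow> Re z \<le> c \<Longrightarrow>
      norm (exp (z * of_real x) * F (- exp x)) \<le> C / (1 + x\<^sup>2)"
    using schwartz_exp_bound[OF F c, of c] by blast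
  have "norm (mellin F z) \<le> (LINT x|lborel. C / (1 + x\<^sup>2))" if "Re z = c" for z
  proof -
    have "integrable lborel (\<lambda>x. exp (z * of_real x) * F (- exp x))"
      using that c by (intro mellin_integrable[OF F]) simp
    then have "norm (mellin F z) \<le> (LINT x|lborel. norm (exp (z * of_real x) * F (- exp x)))"
      unfolding mellin_def by (intro integral_norm_bound)
    also have "\<dots> \<le> (LINT x|lborel. C / (1 + x\<^sup>2))"
      using \<open>integrable lborel (\<lambda>x. exp (z * of_real x) * F (- exp x))\<close> that
      by (intro integral_mono integrable_norm integrable_inverse_1_plus_square' C) simp_all
    finally show ?thesis .
  qed
  moreover have "(LINT x|lborel. C / (1 + x\<^sup>2)) \<ge> 0"
    by (rule integral_nonneg_AE, rule AE_I2) (simp add: C0)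
  ultimately show ?thesis by blast
qed

text \<open>Integrating by parts twice writes the transform as that of F'' at z + 2, divided by z (z
  + 1). The numerator is bounded on the line of abscissa 5/2, so the decay is quadratic.\<close>

lemma mellin_integrable_line:
  assumes F: "F \<in> schwartz_halfline"
  shows "integrable lborel (\<lambda>y. mellin F (Complex (1/2) (- y)))"
proof -
  have F'': "halfline_deriv 2 F \<in> schwartz_halfline" by (rule schwartz_halfline_deriv[OF F])
  obtain B where B0: "B \<ge> 0" and B: "\<And>z. Re z = 5/2 \<Longrightarrow> norm (mellin (halfline_deriv 2 F) z) \<le> B"
    using mellin_bounded_line[OF F'', of "5/2"] by auto
  have bound: "norm (mellin F (Complex (1/2) (- y))) \<le> 4 * B / (1 + y\<^sup>2)" for y
  proof -
    define z where "z = Complex (1/2) (- y)"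
    have z: "Re z > 0" "z \<noteq> 0" "z + 1 \<noteq> 0" by (auto simp: z_def complex_eq_iff)
    define F' where "F' = halfline_deriv 1 F"
    have "z * mellin F z = mellin F' (z + 1)"
      unfolding F'_def by (rule mellin_by_parts[OF F z(1)])
    moreover have "(z + 1) * mellin F' (z + 1) = mellin (halfline_deriv 1 F') (z + 1 + 1)"
      unfolding F'_def by (rule mellin_by_parts[OF schwartz_halfline_deriv[OF F]]) (use z in simp)
    moreover have "halfline_deriv 1 F' = halfline_deriv 2 F"
      unfolding F'_def by (simp only: halfline_deriv_add one_add_one)
    moreover have "z + 1 + 1 = z + 2" by simp
    ultimately have "mellin (halfline_deriv 2 F) (z + 2) = (z * (z + 1)) * mellin F z"
      by (metis mult.assoc mult.commute)
    then have "norm z * norm (z + 1) * norm (mellin F z) \<le> B"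
      using B[of "z + 2"] by (simp add: z_def norm_mult)
    \<comment> \<open>Crude but sufficient: |z + 1| \<ge> |z| because Re z > 0, and |z|^2 = 1/4 +
      y^2.\<close>
    moreover have "(1 + y\<^sup>2) / 4 \<le> norm z * norm (z + 1)"
    proof -
      have "norm z \<le> norm (z + 1)" unfolding z_def by (simp add: cmod_def power2_eq_square)
      then have "norm z * norm z \<le> norm z * norm (z + 1)" by (intro mult_left_mono) auto
      moreover have "norm z * norm z = 1/4 + y\<^sup>2"
        unfolding power2_eq_square[symmetric] cmod_power2 by (simp add: z_def power2_eq_square)
      moreover have "(1 + y\<^sup>2) / 4 \<le> 1/4 + y\<^sup>2" by simp
      ultimately show ?thesis by linarith
    qed
    then have "(1 + y\<^sup>2) / 4 * norm (mellin F z) \<le> norm z * norm (z + 1) * norm (mellin F z)"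
      by (rule mult_right_mono) simp
    ultimately have "(1 + y\<^sup>2) / 4 * norm (mellin F z) \<le> B" by linarith
    moreover have "1 + y\<^sup>2 > 0" by (simp add: add_pos_nonneg)
    ultimately show ?thesis by (simp add: z_def field_simps)
  qed
  show ?thesis
  proof (rule Bochner_Integration.integrable_bound[OF integrable_inverse_1_plus_square'[of "4 * B"]])
    show "(\<lambda>y. mellin F (Complex (1/2) (- y))) \<in> borel_measurable lborel"
      using borel_measurable_continuous_onI[OF mellin_continuous_line[OF F, of "1/2"]] by simp
    show "AE y in lborel. norm (mellin F (Complex (1/2) (- y))) \<le> norm (4 * B / (1 + y\<^sup>2))"
      by (rule AE_I2) (use bound B0 in simp)
  qed
qed

text \<open>The weight e^(x/2) in \<open>h\<close> makes F(-e^x) integrable at minus infinity.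
  Inversion at x = ln v returns the weighted value, and the factor v^(-1/2) in the integrand removes
  the weight.\<close>

lemma mellin_inversion:
  assumes F: "F \<in> schwartz_halfline" and v: "v > 0"
  shows "(LINT y|lborel. mellin F (Complex (1/2) (- y)) * of_real v powr Complex (- 1/2) y) = 2 * of_real pi * F (- v)"
proof -
  define h where "h x = exp (1/2 * complex_of_real x) * F (- exp x)" for x :: real
  have fh: "(LINT x|lborel. h x * iexp (- (y * x))) = mellin F (Complex (1/2) (- y))" for y
    unfolding mellin_def h_def
  proof (intro Bochner_Integration.integral_cong refl)
    fix x
    have "exp (Complex (1/2) (- y) * of_real x) = exp (1/2 * complex_of_real x) * iexp (- (y * x))"
      unfolding mult_exp_exp by (simp add: Complex_eq algebra_simps)
    then show "exp (1/2 * complex_of_real x) * F (- exp x) * iexp (- (y * x)) =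
        exp (Complex (1/2) (- y) * of_real x) * F (- exp x)"
      by (simp only: mult_ac)
  qed
  obtain C where C0: "C \<ge> 0" and C: "\<And>x. norm (h x) \<le> C / (1 + x\<^sup>2)"
  proof -
    have "Re (1/2) = 1/2" by simp
    then show thesis
      using schwartz_exp_bound[OF F, of "1/2" "1/2"] that unfolding h_def
      by (metis half_gt_zero_iff order_refl zero_less_one)
  qed
  have "(LINT y|lborel. mellin F (Complex (1/2) (- y)) * iexp (y * ln v)) = 2 * of_real pi * h (ln v)"
    unfolding fh[symmetric]
  proof (rule Fourier_inversion)
    show "integrable lborel h"
      unfolding h_def by (rule mellin_integrable[OF F]) simp
    show "continuous_on UNIV h"
      unfolding h_def by (intro continuous_intros schwartz_continuous_exp F)
    have "C / (1 + x\<^sup>2) \<le> C" for x :: real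
      using divide_left_mono[of 1 "1 + x\<^sup>2" C] C0 by (simp add: add_pos_nonneg)
    then have "norm (h x) \<le> C" for x using C[of x] by (rule order_trans[rotated])
    then show "bounded (range h)" by (auto simp: bounded_iff)
    show "integrable lborel (\<lambda>y. LINT x|lborel. h x * iexp (- (y * x)))"
      unfolding fh by (rule mellin_integrable_line[OF F])
  qed
  moreover have "mellin F (Complex (1/2) (- y)) * of_real v powr Complex (- 1/2) y =
     exp (- 1/2 * complex_of_real (ln v)) * (mellin F (Complex (1/2) (- y)) * iexp (y * ln v))" for y
  proof -
    have "of_real v powr Complex (- 1/2) y = exp (- 1/2 * complex_of_real (ln v)) * iexp (y * ln v)"
      unfolding powr_of_real_pos[OF v] mult_exp_exp by (simp add: Complex_eq algebra_simps)
    then show ?thesis by (simp only: mult_ac)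
  qed
  ultimately have "(LINT y|lborel. mellin F (Complex (1/2) (- y)) * of_real v powr Complex (- 1/2) y) =
      exp (- 1/2 * complex_of_real (ln v)) * (2 * of_real pi * h (ln v))"
    by (simp only: integral_mult_right_zero)
  also have "\<dots> = (exp (- 1/2 * complex_of_real (ln v)) * exp (1/2 * complex_of_real (ln v))) * (2 * of_real pi * F (- v))"
    using v by (simp add: h_def)
  also have "exp (- 1/2 * complex_of_real (ln v)) * exp (1/2 * complex_of_real (ln v)) = 1"
    unfolding mult_exp_exp by simp
  finally show ?thesis by simp
qed

section \<open>Shifting the order, and the product with \<open>Gamma\<close>\<close>

text \<open>Level k for F' and level k + 1 for \<open>F\<close> are the same expression: same
  derivative, same argument k + 1 - s.\<close>

lemma complex_deriv0_shift:
  assumes F: "F \<in> schwartz_halfline"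
  shows "complex_deriv0 F s = complex_deriv0 (halfline_deriv 1 F) (s - 1)"
proof -
  obtain k where k: "Re (s - 1) < real k" using reals_Archimedean2 by blast
  then have "Re s < real (Suc k)" by simp
  have "complex_deriv0 (halfline_deriv 1 F) (s - 1) =
      mellin (halfline_deriv k (halfline_deriv 1 F)) (of_nat k - (s - 1)) * rGamma (of_nat k - (s - 1))"
    by (rule complex_deriv0_eq[OF schwartz_halfline_deriv[OF F] k])
  moreover have "halfline_deriv k (halfline_deriv 1 F) = halfline_deriv (Suc k) F"
    by (simp only: halfline_deriv_add Suc_eq_plus1)
  moreover have "of_nat k - (s - 1) = of_nat (Suc k) - s" by simp
  ultimately show ?thesis
    using complex_deriv0_eq[OF F \<open>Re s < real (Suc k)\<close>] by (simp only:)
qed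

text \<open>The integrand without its power of -t. The lines in use have half-integer abscissae and
  therefore avoid the poles of Gamma(-s) at the natural numbers.\<close>

definition Gamma_deriv0 :: "(real \<Rightarrow> complex) \<Rightarrow> complex \<Rightarrow> complex" where
  "Gamma_deriv0 F s = Gamma (- s) * complex_deriv0 F s"

lemma Gamma_deriv0_eq_mellin:
  assumes F: "F \<in> schwartz_halfline" and s: "Re s < 0"
  shows "Gamma_deriv0 F s = mellin F (- s)"
proof -
  have "- s \<notin> \<int>\<^sub>\<le>\<^sub>0" using s by (auto elim!: nonpos_Ints_cases simp: complex_eq_iff)
  then have "Gamma (- s) * rGamma (- s) = 1"
    by (simp add: rGamma_inverse_Gamma Gamma_eq_zero_iff)
  then show ?thesis using complex_deriv0_eq[OF F, of s 0] s by (simp add: Gamma_deriv0_def)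
qed

text \<open>At the poles \<open>s = 1, 2, \<dots>\<close> both sides vanish, because \<open>Gamma\<close> is \<open>0\<close> at its poles.\<close>

lemma Gamma_deriv0_shift:
  assumes F: "F \<in> schwartz_halfline" and s: "s \<noteq> 0"
  shows "Gamma_deriv0 F s = Gamma_deriv0 (halfline_deriv 1 F) (s - 1) * (- (1 / s))"
proof -
  \<comment> \<open>The functional equation of \<open>rGamma\<close> has no exceptional points, so
    inverting it covers the poles of \<open>Gamma\<close> as well.\<close>
  have "Gamma (- s) = inverse (- s * rGamma (- s + 1))"
    unfolding rGamma_plus1 by (simp add: rGamma_inverse_Gamma)
  then have "- s * Gamma (- s) = Gamma (- s + 1)"
    using s by (simp add: rGamma_inverse_Gamma)
  then have "Gamma (- (s - 1)) = - s * Gamma (- s)" by simp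
  then show ?thesis using s complex_deriv0_shift[OF F, of s] by (simp add: Gamma_deriv0_def)
qed

section \<open>Inversion on the lines \<open>Re s = N - 1/2\<close>\<close>

text \<open>The primitive v^(c+1) / (c+1) tends to 0 at 0 because c + 1 > 0. As |v^s| = v^(Re s),
  this is also the absolute integrability needed for complex exponents.\<close>

lemma integrable_exp_ln:
  fixes c x :: real
  assumes "c > -1" and x: "x > 0"
  shows "integrable lborel (\<lambda>v. indicator {0<..<x} v *\<^sub>R exp (c * ln v))"
proof -
  have "set_integrable lborel (einterval 0 (ereal x)) (\<lambda>v. exp (c * ln v))"
  proof (rule interval_integral_FTC_nonneg(1)[where F = "\<lambda>v. exp ((c + 1) * ln v) / (c + 1)" and B = "exp ((c + 1) * ln x) / (c + 1)" and A = 0])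
    show "DERIV (\<lambda>v. exp ((c + 1) * ln v) / (c + 1)) v :> exp (c * ln v)" if "0 < ereal v" for v
    proof -
      have "DERIV (\<lambda>v. exp ((c + 1) * ln v) / (c + 1)) v :> exp ((c + 1) * ln v) * ((c + 1) * (1 / v)) / (c + 1)"
        using that by (auto intro!: derivative_eq_intros)
      moreover have "exp ((c + 1) * ln v) = exp (c * ln v) * v"
        using that by (simp add: ring_distribs exp_add)
      ultimately show ?thesis using that assms by simp
    qed
    show "isCont (\<lambda>v. exp (c * ln v)) v" if "0 < ereal v" for v
      using that by (intro continuous_intros) auto
    show "(((\<lambda>v. exp ((c + 1) * ln v) / (c + 1)) \<circ> real_of_ereal) \<longlongrightarrow> 0) (at_right 0)"
    proof -
      have "filterlim (\<lambda>v. (c + 1) * ln v) at_bot (at_right 0)"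
        using assms by (intro filterlim_tendsto_pos_mult_at_bot[OF tendsto_const _ ln_at_0]) simp
      then have "((\<lambda>v. exp ((c + 1) * ln v)) \<longlongrightarrow> 0) (at_right 0)"
        by (rule filterlim_compose[OF exp_at_bot])
      then show ?thesis
        unfolding zero_ereal_def ereal_tendsto_simps by (rule tendsto_divide_zero)
    qed
    show "(((\<lambda>v. exp ((c + 1) * ln v) / (c + 1)) \<circ> real_of_ereal) \<longlongrightarrow> exp ((c + 1) * ln x) / (c + 1)) (at_left (ereal x))"
      unfolding ereal_tendsto_simps using assms by (intro tendsto_intros) auto
  qed (use x in auto)
  moreover have "einterval 0 (ereal x) = {0<..<x}" by (auto simp: einterval_def)
  ultimately show ?thesis by (simp add: set_integrable_def)
qed

text \<open>Source of the division that moves one line to the right: up to sign, 1/(s + 1) is the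
  factor relating \<open>Gamma_deriv0\<close> of \<open>F\<close> at s + 1 to that of F' at
  s.\<close>

lemma integral_exp_ln:
  fixes x :: real
  assumes s: "Re s > -1" and x: "x > 0"
  shows "(LINT v|lborel. indicator {0<..<x} v *\<^sub>R exp (s * complex_of_real (ln v))) = of_real x powr (s + 1) / (s + 1)"
proof -
  have s1: "s + 1 \<noteq> 0" using s by (auto simp: complex_eq_iff)
  have E: "einterval 0 (ereal x) = {0<..<x}" by (auto simp: einterval_def)
  have "(LBINT v=0..ereal x. exp (s * complex_of_real (ln v))) = exp ((s + 1) * complex_of_real (ln x)) / (s + 1) - 0"
  proof (rule interval_integral_FTC_integrable[where F = "\<lambda>v. exp ((s + 1) * complex_of_real (ln v)) / (s + 1)"])
    show "((\<lambda>v. exp ((s + 1) * complex_of_real (ln v)) / (s + 1)) has_vector_derivative exp (s * complex_of_real (ln v))) (at v)"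
      if "0 < ereal v" for v
    proof -
      have v: "v > 0" using that by simp
      have "((\<lambda>v. complex_of_real (ln v)) has_vector_derivative of_real (1 / v)) (at v)"
        by (rule has_vector_derivative_of_real)
           (use v in \<open>auto intro!: derivative_eq_intros simp: field_simps simp flip: has_real_derivative_iff_has_vector_derivative\<close>)
      moreover have "((\<lambda>w. exp ((s + 1) * w) / (s + 1)) has_field_derivative exp ((s + 1) * complex_of_real (ln v))) (at (complex_of_real (ln v)))"
        using s1 by (auto intro!: derivative_eq_intros)
      ultimately have "((\<lambda>w. exp ((s + 1) * w) / (s + 1)) \<circ> (\<lambda>v. complex_of_real (ln v)) has_vector_derivative
          of_real (1 / v) * exp ((s + 1) * complex_of_real (ln v))) (at v)"
        by (rule field_vector_diff_chain_at)
      moreover have "of_real (1 / v) * exp ((s + 1) * complex_of_real (ln v)) = exp (s * complex_of_real (ln v))"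
        using v by (simp add: ring_distribs exp_add exp_of_real)
      ultimately show ?thesis by (simp add: o_def)
    qed
    show "isCont (\<lambda>v. exp (s * complex_of_real (ln v))) v" if "0 < ereal v" for v
      using that by (intro continuous_intros) auto
    show "set_integrable lborel (einterval 0 (ereal x)) (\<lambda>v. exp (s * complex_of_real (ln v)))"
      unfolding E
    proof (rule set_integrable_bound)
      show "set_integrable lborel {0<..<x} (\<lambda>v. exp (Re s * ln v))"
        using integrable_exp_ln[OF s x] by (simp add: set_integrable_def)
      show "set_borel_measurable lborel {0<..<x} (\<lambda>v. exp (s * complex_of_real (ln v)))"
        unfolding set_borel_measurable_def by measurable
    qed simp
    show "(((\<lambda>v. exp ((s + 1) * complex_of_real (ln v)) / (s + 1)) \<circ> real_of_ereal) \<longlongrightarrow> 0) (at_right 0)"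
    proof -
      have "filterlim (\<lambda>v. (Re s + 1) * ln v) at_bot (at_right 0)"
        using s by (intro filterlim_tendsto_pos_mult_at_bot[OF tendsto_const _ ln_at_0]) simp
      then have "((\<lambda>v. exp ((Re s + 1) * ln v)) \<longlongrightarrow> 0) (at_right 0)"
        by (rule filterlim_compose[OF exp_at_bot])
      then have "((\<lambda>v. exp ((s + 1) * complex_of_real (ln v))) \<longlongrightarrow> 0) (at_right 0)"
        by (intro tendsto_norm_zero_cancel[where f = "\<lambda>v. exp ((s + 1) * complex_of_real (ln v))"]) simp
      then show ?thesis
        unfolding zero_ereal_def ereal_tendsto_simps by (rule tendsto_divide_zero)
    qed
    show "(((\<lambda>v. exp ((s + 1) * complex_of_real (ln v)) / (s + 1)) \<circ> real_of_ereal) \<longlongrightarrow>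
        exp ((s + 1) * complex_of_real (ln x)) / (s + 1)) (at_left (ereal x))"
      unfolding ereal_tendsto_simps using s1 x by (intro tendsto_intros) auto
  qed (use x in auto)
  then show ?thesis
    using x by (simp add: interval_lebesgue_integral_def set_lebesgue_integral_def E powr_of_real_pos)
qed

section \<open>Taylor remainders\<close>

text \<open>Exactly \<open>N\<close> terms are subtracted, matching the line Re s = N - 1/2; for
  \<open>N = 0\<close> this is the function itself, which is the base case.\<close>

definition Taylor_remainder :: "nat \<Rightarrow> (real \<Rightarrow> complex) \<Rightarrow> real \<Rightarrow> complex" where
  "Taylor_remainder N F t = F t - (\<Sum>n<N. halfline_deriv n F 0 / fact n * complex_of_real t ^ n)"

lemma Taylor_remainder_Suc_0: "Taylor_remainder (Suc N) F 0 = 0"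
  unfolding Taylor_remainder_def sum.lessThan_Suc_shift by simp

text \<open>Differentiation kills the constant term and lowers each remaining index by one.
  \<open>halfline_deriv\<close> recurses from the outside, so \<open>halfline_deriv_add\<close> is
  what identifies derivative n + 1 of \<open>F\<close> with derivative n of F'.\<close>

lemma Taylor_remainder_Suc_has_derivative:
  assumes F: "F \<in> schwartz_halfline" and t: "t \<le> 0"
  shows "(Taylor_remainder (Suc N) F has_vector_derivative
    Taylor_remainder N (halfline_deriv 1 F) t) (at t within {..0})"
proof -
  have summand: "((\<lambda>t. halfline_deriv (Suc n) F 0 / fact (Suc n) * complex_of_real t ^ Suc n) has_vector_derivative
      halfline_deriv n (halfline_deriv 1 F) 0 / fact n * complex_of_real t ^ n) (at t within {..0})" for n
  proof -
    have "((\<lambda>z. halfline_deriv (Suc n) F 0 / fact (Suc n) * z ^ Suc n) has_field_derivative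
        halfline_deriv (Suc n) F 0 / fact (Suc n) * (of_nat (Suc n) * complex_of_real t ^ n)) (at (of_real t))"
      by (auto intro!: derivative_eq_intros simp del: power_Suc halfline_deriv.simps)
    then have "((\<lambda>t. halfline_deriv (Suc n) F 0 / fact (Suc n) * complex_of_real t ^ Suc n) has_vector_derivative
        halfline_deriv (Suc n) F 0 / fact (Suc n) * (of_nat (Suc n) * complex_of_real t ^ n)) (at t)"
      by (rule has_vector_derivative_real_field)
    moreover have "halfline_deriv (Suc n) F 0 / fact (Suc n) * (of_nat (Suc n) * complex_of_real t ^ n) =
        halfline_deriv n (halfline_deriv 1 F) 0 / fact n * complex_of_real t ^ n"
      unfolding halfline_deriv_add Suc_eq_plus1[symmetric] fact_Suc
      by (simp add: divide_simps del: halfline_deriv.simps of_nat_Suc)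
    ultimately show ?thesis by (metis has_vector_derivative_at_within)
  qed
  have "((\<lambda>t. F t - (halfline_deriv 0 F 0 / fact 0 * complex_of_real t ^ 0 +
        (\<Sum>n<N. halfline_deriv (Suc n) F 0 / fact (Suc n) * complex_of_real t ^ Suc n)))
      has_vector_derivative halfline_deriv 1 F t - (0 + (\<Sum>n<N. halfline_deriv n (halfline_deriv 1 F) 0 / fact n * complex_of_real t ^ n)))
      (at t within {..0})"
    unfolding power_0 mult_1_right
    by (intro has_vector_derivative_diff has_vector_derivative_add has_vector_derivative_sum
        has_vector_derivative_const summand schwartz_has_vector_derivative_within[OF F t])
  then show ?thesis
    unfolding Taylor_remainder_def sum.lessThan_Suc_shift add_0 .
qed

text \<open>Fundamental theorem of calculus after the reflection v = -t, which causes the minus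
  sign. The boundary term at 0 vanishes because at least the constant term has been
  subtracted.\<close>

lemma Taylor_remainder_integral:
  assumes F: "F \<in> schwartz_halfline" and x: "x > 0"
  shows "(LINT v|lborel. indicator {0<..<x} v *\<^sub>R Taylor_remainder N (halfline_deriv 1 F) (- v)) =
    - Taylor_remainder (Suc N) F (- x)"
proof -
  define f where "f v = - Taylor_remainder N (halfline_deriv 1 F) (- v)" for v
  have F': "halfline_deriv 1 F \<in> schwartz_halfline" by (rule schwartz_halfline_deriv[OF F])
  have "(LINT v|lborel. indicator {0..x} v *\<^sub>R f v) =
      Taylor_remainder (Suc N) F (- x) - Taylor_remainder (Suc N) F (- 0)"
  proof (rule integral_FTC_atLeastAtMost)
    show "((\<lambda>v. Taylor_remainder (Suc N) F (- v)) has_vector_derivative f v) (at v within {0..x})"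
      if "0 \<le> v" "v \<le> x" for v
    proof -
      have "(Taylor_remainder (Suc N) F has_vector_derivative
          Taylor_remainder N (halfline_deriv 1 F) (- v)) (at (- v) within uminus ` {0..x})"
        by (rule has_vector_derivative_within_subset[OF Taylor_remainder_Suc_has_derivative[OF F]])
           (use that in \<open>simp_all add: image_subset_iff\<close>)
      moreover have "(uminus has_vector_derivative - 1) (at v within {0..x})"
        by (auto intro!: derivative_eq_intros)
      ultimately have "(Taylor_remainder (Suc N) F \<circ> uminus has_vector_derivative
          (- 1) *\<^sub>R Taylor_remainder N (halfline_deriv 1 F) (- v)) (at v within {0..x})"
        by (intro vector_diff_chain_within)
      then show ?thesis by (simp only: o_def f_def scaleR_minus_left scaleR_one)
    qed
    have "continuous_on {0..x} (\<lambda>v. halfline_deriv 1 F (- v))"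
    proof (rule continuous_on_compose2[OF schwartz_continuous_on[OF F']])
      show "continuous_on {0..x} uminus" by (intro continuous_intros)
    qed (simp add: image_subset_iff)
    then show "continuous_on {0..x} f"
      unfolding f_def Taylor_remainder_def by (intro continuous_intros)
  qed (use x in simp)
  also have "(LINT v|lborel. indicator {0..x} v *\<^sub>R f v) =
      (LINT v:{0..x}|lborel. f v)"
    by (simp only: set_lebesgue_integral_def)
  also have "\<dots> = (LINT v:{0<..<x}|lborel. f v)"
    using x interval_integral_Icc[of 0 x f] interval_integral_Ioo[of 0 x f] by (simp add: zero_ereal_def)
  also have "\<dots> = - (LINT v|lborel. indicator {0<..<x} v *\<^sub>R Taylor_remainder N (halfline_deriv 1 F) (- v))"
    unfolding set_lebesgue_integral_def f_def scaleR_minus_right by (rule integral_minus)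
  finally show ?thesis
    by (simp add: Taylor_remainder_Suc_0 del: halfline_deriv.simps) (metis minus_minus)
qed

section \<open>Line integrals and the induction on the line\<close>

lemma Gamma_deriv0_base_line:
  assumes F: "F \<in> schwartz_halfline"
  shows "Gamma_deriv0 F (Complex (- 1/2) y) = mellin F (Complex (1/2) (- y))"
proof -
  have "- Complex (- 1/2) y = Complex (1/2) (- y)" by (simp add: complex_eq_iff)
  then show ?thesis using Gamma_deriv0_eq_mellin[OF F, of "Complex (- 1/2) y"] by simp
qed

lemma Gamma_deriv0_line_Suc:
  assumes F: "F \<in> schwartz_halfline"
  shows "Gamma_deriv0 F (Complex (real (Suc N) - 1/2) y) =
    Gamma_deriv0 (halfline_deriv 1 F) (Complex (real N - 1/2) y) * (- (1 / Complex (real (Suc N) - 1/2) y))"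
proof -
  have "Complex (real (Suc N) - 1/2) y \<noteq> 0"
    by (simp add: complex_eq_iff)
  moreover have "Complex (real (Suc N) - 1/2) y - 1 = Complex (real N - 1/2) y"
    by (simp add: complex_eq_iff)
  ultimately show ?thesis by (metis Gamma_deriv0_shift[OF F])
qed

lemma Gamma_deriv0_integrable_line:
  assumes "F \<in> schwartz_halfline"
  shows "integrable lborel (\<lambda>y. Gamma_deriv0 F (Complex (real N - 1/2) y))"
  using assms
proof (induction N arbitrary: F)
  case 0
  show ?case using mellin_integrable_line[OF 0] by (simp add: Gamma_deriv0_base_line[OF 0, simplified])
next
  case (Suc N)
  define s where "s y = Complex (real (Suc N) - 1/2) y" for y
  have s_ne: "s y \<noteq> 0" for y by (auto simp: s_def complex_eq_iff)
  \<comment> \<open>After a step the abscissa is at least 1/2, so dividing by \<open>s\<close> costs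
    at most a factor 2.\<close>
  have s_ge: "norm (1 / s y) \<le> 2" for y
  proof -
    have "1/2 \<le> Re (s y)" by (simp add: s_def)
    also have "\<dots> \<le> norm (s y)" by (rule complex_Re_le_cmod)
    finally show ?thesis by (simp add: norm_divide divide_simps)
  qed
  have s_cont: "continuous_on UNIV s" unfolding s_def Complex_eq by (intro continuous_intros)
  have IH: "integrable lborel (\<lambda>y. Gamma_deriv0 (halfline_deriv 1 F) (Complex (real N - 1/2) y))"
    by (rule Suc.IH[OF schwartz_halfline_deriv[OF Suc.prems]])
  have eq: "Gamma_deriv0 F (s y) = Gamma_deriv0 (halfline_deriv 1 F) (Complex (real N - 1/2) y) * (- (1 / s y))" for y
    unfolding s_def by (rule Gamma_deriv0_line_Suc[OF Suc.prems])
  have [measurable]: "(\<lambda>y. Gamma_deriv0 (halfline_deriv 1 F) (Complex (real N - 1/2) y)) \<in> borel_measurable borel"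
    using borel_measurable_integrable[OF IH] by simp
  have [measurable]: "(\<lambda>y. - (1 / s y)) \<in> borel_measurable borel"
    by (intro borel_measurable_continuous_onI continuous_intros s_cont) (simp add: s_ne)
  have "integrable lborel (\<lambda>y. Gamma_deriv0 F (s y))"
    unfolding eq
  proof (rule Bochner_Integration.integrable_bound)
    show "integrable lborel (\<lambda>y. 2 * norm (Gamma_deriv0 (halfline_deriv 1 F) (Complex (real N - 1/2) y)))"
      using IH by (intro integrable_mult_right integrable_norm)
    show "AE y in lborel. norm (Gamma_deriv0 (halfline_deriv 1 F) (Complex (real N - 1/2) y) * (- (1 / s y)))
        \<le> norm (2 * norm (Gamma_deriv0 (halfline_deriv 1 F) (Complex (real N - 1/2) y)))"
    proof (rule AE_I2)
      fix y
      let ?a = "norm (Gamma_deriv0 (halfline_deriv 1 F) (Complex (real N - 1/2) y))"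
      have "?a * norm (1 / s y) \<le> ?a * 2" by (intro mult_left_mono s_ge) simp
      moreover have "norm (2 * ?a) = ?a * 2" by simp
      ultimately show "norm (Gamma_deriv0 (halfline_deriv 1 F) (Complex (real N - 1/2) y) * (- (1 / s y))) \<le> norm (2 * ?a)"
        by (simp only: norm_mult norm_minus_cancel)
    qed
  qed measurable
  then show ?case by (simp only: s_def)
qed

text \<open>Both \<open>F\<close> and \<open>x\<close> vary in the induction, because the step uses
  the hypothesis for F' at every point v of ]0, x[.\<close>

lemma Gamma_deriv0_inversion:
  assumes "F \<in> schwartz_halfline" "x > 0"
  shows "(LINT y|lborel. Gamma_deriv0 F (Complex (real N - 1/2) y) * complex_of_real x powr Complex (real N - 1/2) y) =
    2 * of_real pi * Taylor_remainder N F (- x)"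
  using assms
proof (induction N arbitrary: F x)
  case 0
  have "Taylor_remainder 0 F (- x) = F (- x)" by (simp add: Taylor_remainder_def)
  then show ?case
    using mellin_inversion[OF 0] by (simp add: Gamma_deriv0_base_line[OF 0(1), simplified])
next
  case (Suc N)
  note F = Suc.prems(1) and x = Suc.prems(2)
  define F' where "F' = halfline_deriv 1 F"
  have F': "F' \<in> schwartz_halfline" unfolding F'_def by (rule schwartz_halfline_deriv[OF F])
  define c where "c = real N - 1/2"
  have c: "c > - 1" by (simp add: c_def)
  \<comment> \<open>The integrand is split into the shape of \<open>Fubini_phase\<close>:
    \<open>a\<close> depends on \<open>y\<close> only, \<open>b\<close> is the modulus v^c cut off
    to ]0, x[, and the remaining v^(i y) is the phase.\<close>
  define a where "a y = Gamma_deriv0 F' (Complex c y)" for y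
  define b where "b v = complex_of_real (indicator {0<..<x} v *\<^sub>R exp (c * ln v))" for v
  have a: "integrable lborel a"
    unfolding a_def c_def by (rule Gamma_deriv0_integrable_line[OF F'])
  have b: "integrable lborel b"
    unfolding b_def by (intro integrable_of_real integrable_exp_ln c x)
  have ab: "a y * b v * iexp (y * ln v) =
      a y * (indicator {0<..<x} v *\<^sub>R exp (Complex c y * complex_of_real (ln v)))" for y v
  proof -
    have "complex_of_real (exp (c * ln v)) * iexp (y * ln v) = exp (Complex c y * complex_of_real (ln v))"
      unfolding exp_of_real[symmetric] mult_exp_exp by (simp add: Complex_eq algebra_simps)
    then show ?thesis
      by (cases "v \<in> {0<..<x}") (simp_all add: b_def mult.assoc del: of_real_mult)
  qed
  \<comment> \<open>Read from right to left: integrating v^s over ]0, x[ gives x^(s+1) / (s+1), and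
    the shift formula contributes the same divisor with a minus sign. That sign later cancels the
    one from \<open>Taylor_remainder_integral\<close>.\<close>
  have "Gamma_deriv0 F (Complex (real (Suc N) - 1/2) y) * of_real x powr Complex (real (Suc N) - 1/2) y =
      - (LINT v|lborel. a y * b v * iexp (y * ln v))" for y
  proof -
    have s: "Complex c y + 1 = Complex (real (Suc N) - 1/2) y"
      by (simp add: c_def complex_eq_iff)
    have "(LINT v|lborel. a y * b v * iexp (y * ln v)) = a y * (of_real x powr (Complex c y + 1) / (Complex c y + 1))"
      unfolding ab integral_mult_right_zero by (subst integral_exp_ln) (use c x in simp_all)
    then show ?thesis
      unfolding Gamma_deriv0_line_Suc[OF F] s by (simp add: a_def c_def F'_def del: halfline_deriv.simps)
  qed
  then have "(LINT y|lborel. Gamma_deriv0 F (Complex (real (Suc N) - 1/2) y) * of_real x powr Complex (real (Suc N) - 1/2) y) =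
      - (LINT y|lborel. LINT v|lborel. a y * b v * iexp (y * ln v))"
    by (simp only: integral_minus)
  also have "(LINT y|lborel. LINT v|lborel. a y * b v * iexp (y * ln v)) =
      (LINT v|lborel. LINT y|lborel. a y * b v * iexp (y * ln v))"
    by (rule Fubini_phase[symmetric, OF a b]) measurable
  also have "\<dots> = (LINT v|lborel. 2 * of_real pi * (indicator {0<..<x} v *\<^sub>R Taylor_remainder N F' (- v)))"
  proof (intro Bochner_Integration.integral_cong refl)
    fix v
    show "(LINT y|lborel. a y * b v * iexp (y * ln v)) =
        2 * of_real pi * (indicator {0<..<x} v *\<^sub>R Taylor_remainder N F' (- v))"
    proof (cases "v \<in> {0<..<x}")
      case True
      then have "a y * b v * iexp (y * ln v) = a y * of_real v powr Complex c y" for y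
        unfolding ab by (simp add: powr_of_real_pos)
      then have "(LINT y|lborel. a y * b v * iexp (y * ln v)) = (LINT y|lborel. a y * of_real v powr Complex c y)"
        by (simp only:)
      then show ?thesis
        using Suc.IH[OF F', of v] True by (simp add: a_def c_def)
    qed (simp add: b_def)
  qed
  also have "\<dots> = 2 * of_real pi * - Taylor_remainder (Suc N) F (- x)"
    unfolding integral_mult_right_zero F'_def Taylor_remainder_integral[OF F x] ..
  finally show ?case by simp
qed

theorem mainTheorem2:
  fixes F :: "real \<Rightarrow> complex" and N :: nat and t :: real
  assumes "F \<in> schwartz_halfline" and "t \<le> 0"
  shows "vline_integrable (real N + 1/2)
           (\<lambda>s. Gamma (- s) * complex_deriv0 F s * complex_of_real (- t) powr s) \<and>
         F t = (\<Sum>n=0..N. halfline_deriv n F 0 / fact n * complex_of_real t ^ n) +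
           1 / (2 * \<i> * complex_of_real pi) *
           vline_integral (real N + 1/2)
             (\<lambda>s. Gamma (- s) * complex_deriv0 F s * complex_of_real (- t) powr s)"
proof (cases "t = 0")
  case True
  \<comment> \<open>Here \<open>0 ^ 0 = 1\<close> keeps only the constant term, while
    \<open>0 powr s = 0\<close> makes the line integrand vanish identically.\<close>
  have "(\<Sum>n=0..N. halfline_deriv n F 0 / fact n * complex_of_real 0 ^ n) = F 0"
    unfolding atLeast0AtMost sum.atMost_shift by simp
  then show ?thesis
    using True by (simp add: vline_integrable_def vline_integral_def)
next
  case False
  define x where "x = - t"
  have x: "x > 0" using False assms(2) by (simp add: x_def)
  define c where "c = real N + 1/2"
  \<comment> \<open>The line Re s = N + 1/2 belongs to index \<open>Suc N\<close>, whose remainder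
    subtracts precisely the terms n \<le> N.\<close>
  have c: "c = real (Suc N) - 1/2" by (simp add: c_def)
  define g where "g y = Gamma_deriv0 F (Complex c y) * complex_of_real x powr Complex c y" for y
  have G_int: "integrable lborel (\<lambda>y. Gamma_deriv0 F (Complex c y))"
    unfolding c by (rule Gamma_deriv0_integrable_line[OF assms(1)])
  have powr: "complex_of_real x powr Complex c y = exp (Complex c y * complex_of_real (ln x))" for y
    by (rule powr_of_real_pos[OF x])
  \<comment> \<open>On the line |x^s| is the constant x^c, so the power does not disturb
    integrability.\<close>
  have g_int: "integrable lborel g"
  proof (rule Bochner_Integration.integrable_bound)
    show "integrable lborel (\<lambda>y. Gamma_deriv0 F (Complex c y) * of_real (exp (c * ln x)))"
      using G_int by simp
    have "(\<lambda>y. exp (Complex c y * complex_of_real (ln x))) \<in> borel_measurable borel"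
      unfolding Complex_eq by (intro borel_measurable_continuous_onI continuous_intros)
    then show "g \<in> borel_measurable lborel"
      unfolding g_def powr using borel_measurable_integrable[OF G_int]
      by (intro borel_measurable_times) simp_all
    show "AE y in lborel. norm (g y) \<le> norm (Gamma_deriv0 F (Complex c y) * of_real (exp (c * ln x)))"
      by (rule AE_I2) (simp add: g_def powr norm_mult)
  qed
  have "(LINT y|lborel. g y) = 2 * of_real pi * Taylor_remainder (Suc N) F t"
    using Gamma_deriv0_inversion[OF assms(1) x, of "Suc N"] unfolding g_def c by (simp add: x_def)
  \<comment> \<open>The factor i from ds = i dy cancels against 1/(2 i pi), leaving 1/(2 pi) to meet
    the 2 pi of the inversion formula.\<close>
  moreover have "vline_integral c (\<lambda>s. Gamma (- s) * complex_deriv0 F s * complex_of_real (- t) powr s) = (LINT y|lborel. g y) * \<i>"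
    unfolding vline_integral_def Gamma_deriv0_def[symmetric] x_def[symmetric] g_def[symmetric] by simp
  ultimately have "1 / (2 * \<i> * complex_of_real pi) *
      vline_integral c (\<lambda>s. Gamma (- s) * complex_deriv0 F s * complex_of_real (- t) powr s) = Taylor_remainder (Suc N) F t"
    by (simp add: mult_ac)
  moreover have "vline_integrable c (\<lambda>s. Gamma (- s) * complex_deriv0 F s * complex_of_real (- t) powr s)"
    unfolding vline_integrable_def Gamma_deriv0_def[symmetric] x_def[symmetric] g_def[symmetric]
    using g_int by simp
  ultimately show ?thesis
    unfolding c_def by (simp add: Taylor_remainder_def atLeast0AtMost lessThan_Suc_atMost)
qed

end
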